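(* Let $G=(V,E)$ be a regular graph of even degree $d\geq 3$, with parity block decomposition $G=\cup_{j\in J} P_j$. Let $C_d$ be the cycle graph of length $d$, with vertex set $[d]$. Then there is a one-to-one correspondence between the set of parity blocks $\{P_j\}_{j\in J}$ and the set of connected components $\{S_j\}_{j\in J}$ of the zig-zag product $G\circ_z C_d$.
   Context: $G$ is a finite connected bi-labelled $d$-regular graph: at each vertex the incident edges get distinct colors from $[d]=\{1,\dots,d\}$, encoded by a rotation map $\operatorname{Rot}_G(v,h)=(w,k)$ if an edge joins $v,w$ colored $h$ near $v$ and $k$ near $w$. $C_d$ has vertex set $[d]$, vertex $k$ adjacent to $k\pm1$ (indices mod $d$, taken in $[d]$). The zig-zag product $G\circ_z C_d$ has vertex set $V\times[d]$ and rotation map $\operatorname{Rot}((v,k),(i,j))=((w,l),(j',i'))$ whenever $\operatorname{Rot}_{C_d}(k,i)=(k',i')$, $\operatorname{Rot}_{G}(v,k')=(w,l')$, $\operatorname{Rot}_{C_d}(l',j)=(l,j')$. Let $[d_e]$ (resp. $[d_o]$) be the even (resp. odd) elements of $[d]$. For $v\in V$ and $i\in\{e,o\}$, the parity block $P(v,i)$ is the subgraph of $G$ whose vertices are all $w$ reachable from $v$ by a path $v=v_0,v_1,\dots,v_n=w$ with $\operatorname{Rot}_G(v_k,i_k)=(v_{k+1},j_k)$, $i_0\in[d_i]$ and $i_{k+1}\equiv j_k \pmod 2$, and whose edges are the edges (with their bi-labelling) used by such paths. If $w\in P(v,i)$ has parity $i_w$ (parity of the last label $j_{n-1}$ of such a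 path), then $P(v,i)=P(w,i_w)$; hence $G$ decomposes uniquely into parity blocks, written $G=\cup_j P_j$ (the parity block decomposition). *)

theory Defs
  imports "Graph_Theory.Digraph_Component" "HOL-Number_Theory.Cong"
begin

text \<open>
  A bi-labelled regular graph is encoded by its rotation map: \<open>Rot G (v, h) = (w, k)\<close> means that
  an edge joins \<open>v\<close> and \<open>w\<close> and is coloured \<open>h\<close> near \<open>v\<close> and \<open>k\<close> near \<open>w\<close>. The edge itself is the
  orbit \<open>{(v, h), (w, k)}\<close> of \<open>Rot G\<close>, so multiple edges and loops are allowed. The degree is the
  number of colours.
\<close>

record ('v, 'c) rot_graph =
  Verts :: "'v set"
  Cols :: "'c set"
  Rot :: "'v \<times> 'c \<Rightarrow> 'v \<times> 'c"

definition bilabelled_graph :: "('v, 'c) rot_graph \<Rightarrow> bool" where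
  "bilabelled_graph G \<longleftrightarrow>
     finite (Verts G) \<and> finite (Cols G) \<and>
     (\<forall>x \<in> Verts G \<times> Cols G. Rot G x \<in> Verts G \<times> Cols G \<and> Rot G (Rot G x) = x)"

definition bilabelled_regular_graph :: "nat \<Rightarrow> ('v, nat) rot_graph \<Rightarrow> bool" where
  "bilabelled_regular_graph d G \<longleftrightarrow> bilabelled_graph G \<and> Cols G = {1..d}"

text \<open>
  The graph itself, as a symmetric multi-digraph: the pair \<open>(v, h)\<close> is the arc that leaves \<open>v\<close>
  along the edge coloured \<open>h\<close> near \<open>v\<close>; the same edge in the opposite direction is \<open>Rot G (v, h)\<close>.
\<close>

definition graph_of :: "('v, 'c) rot_graph \<Rightarrow> ('v, 'v \<times> 'c) pre_digraph" where
  "graph_of G = \<lparr> verts = Verts G, arcs = Verts G \<times> Cols G, tail = fst, head = (\<lambda>x. fst (Rot G x)) \<rparr>"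

definition connected_components :: "('v, 'c) rot_graph \<Rightarrow> ('v, 'v \<times> 'c) pre_digraph set" where
  "connected_components G = {S. pre_digraph.max_subgraph (graph_of G) Digraph_Component.connected S}"

text \<open>
  The cycle graph on \<open>[d]\<close>, with an arbitrary bi-labelling by \<open>[2]\<close>.
\<close>

definition cycle_graph :: "nat \<Rightarrow> (nat, nat) rot_graph \<Rightarrow> bool" where
  "cycle_graph d C \<longleftrightarrow>
     bilabelled_regular_graph 2 C \<and> Verts C = {1..d} \<and>
     (\<forall>k \<in> {1..d}. {fst (Rot C (k, i)) | i. i \<in> {1..2}} =
        {l \<in> {1..d}. [l = k + 1] (mod d) \<or> [l + 1 = k] (mod d)})"

definition zigzag :: "('v, 'u) rot_graph \<Rightarrow> ('u, 'c) rot_graph \<Rightarrow> ('v \<times> 'u, 'c \<times> 'c) rot_graph" where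
  "zigzag G H =
     \<lparr> Verts = Verts G \<times> Verts H, Cols = Cols H \<times> Cols H,
       Rot = (\<lambda>((v, k), (i, j)).
         let (k', i') = Rot H (k, i);
             (w, l') = Rot G (v, k');
             (l, j') = Rot H (l', j)
         in ((w, l), (j', i'))) \<rparr>"

datatype parity = Even | Odd

fun parity_cols :: "('v, nat) rot_graph \<Rightarrow> parity \<Rightarrow> nat set" where
  "parity_cols G Even = {h \<in> Cols G. even h}"
| "parity_cols G Odd = {h \<in> Cols G. odd h}"

text \<open>
  The list \<open>p\<close> consists of the pairs \<open>(v\<^sub>k, i\<^sub>k)\<close>; vertices and edges may be repeated.
\<close>

definition parity_path ::
  "('v, nat) rot_graph \<Rightarrow> 'v \<Rightarrow> parity \<Rightarrow> ('v \<times> nat) list \<Rightarrow> 'v \<Rightarrow> bool" where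
  "parity_path G v i p w \<longleftrightarrow>
     pre_digraph.awalk (graph_of G) v p w \<and> p \<noteq> [] \<and> snd (hd p) \<in> parity_cols G i \<and>
     (\<forall>k. Suc k < length p \<longrightarrow> [snd (p ! Suc k) = snd (Rot G (p ! k))] (mod 2))"

text \<open>
  An edge used by a path contributes both of its arcs.
\<close>

definition parity_block ::
  "('v, nat) rot_graph \<Rightarrow> 'v \<Rightarrow> parity \<Rightarrow> ('v, 'v \<times> nat) pre_digraph" where
  "parity_block G v i =
     \<lparr> verts = {w. \<exists>p. parity_path G v i p w},
       arcs = (\<Union>x \<in> {x. \<exists>p w. parity_path G v i p w \<and> x \<in> set p}. {x, Rot G x}),
       tail = tail (graph_of G), head = head (graph_of G) \<rparr>"

definition parity_blocks :: "('v, nat) rot_graph \<Rightarrow> ('v, 'v \<times> nat) pre_digraph set" where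
  "parity_blocks G = {parity_block G v i | v i. v \<in> Verts G}"

end

theory Submission
  imports Defs
begin

text \<open>
  Call a pair of a vertex and a parity a state, and let every edge \<open>Rot G (v, h) = (w, k)\<close> join the
  state \<open>(v, h mod 2)\<close> to \<open>(w, k mod 2)\<close>. The arcs of a parity block are those issuing from the states
  of one connected class, so blocks correspond to classes of states. As \<open>d\<close> is even, a step in
  \<open>C\<^sub>d\<close> flips the parity, so an edge of the zig-zag product leaving \<open>(v, k)\<close> uses an edge of \<open>G\<close>
  leaving the state \<open>(v, (k + 1) mod 2)\<close>. Conversely, \<open>(v, k)\<close> and \<open>(v, k + 2)\<close> have a common
  neighbour in the product, reached through the edge of \<open>G\<close> coloured \<open>k + 1\<close> at \<open>v\<close>; hence all
  vertices over one state lie in one component, and components correspond to classes of states too.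
\<close>

section \<open>Connected components of symmetric digraphs\<close>

context sym_digraph
begin

text \<open>Connectedness refers to the symmetric closure. Passing from \<open>H\<close> to
  \<open>G\<close> enlarges this closure, and as \<open>G\<close> is symmetric its own closure adds
  no reachability.\<close>

lemma connected_subgraph_reachable:
  assumes "subgraph H G" "Digraph_Component.connected H" "u \<in> verts H" "v \<in> verts H"
  shows "u \<rightarrow>\<^sup>* v"
proof -
  have "u \<rightarrow>\<^sup>*\<^bsub>mk_symmetric H\<^esub> v"
    using assms by (auto simp: connected_def strongly_connected_def)
  then have "u \<rightarrow>\<^sup>*\<^bsub>mk_symmetric G\<^esub> v"
    using subgraph_mk_symmetric[OF assms(1)] by (rule pre_digraph.reachable_mono)
  then show ?thesis using reachable_mk_symmetric_eq[OF sym_arcs] by simp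
qed

text \<open>Walks from \<open>u\<close> stay inside the restriction, which inherits symmetry from
  \<open>G\<close>; so two of its vertices are joined by going back to \<open>u\<close> and out
  again.\<close>

lemma connected_induce_reachable:
  assumes "u \<in> verts G"
  shows "Digraph_Component.connected (G \<restriction> {w. u \<rightarrow>\<^sup>* w})"
proof -
  let ?H = "G \<restriction> {w. u \<rightarrow>\<^sup>* w}"
  have sub: "{w. u \<rightarrow>\<^sup>* w} \<subseteq> verts G" using reachable_in_verts(2) by auto
  interpret H: sym_digraph ?H
    using induced_graph_imp_graph[OF induced_induce[OF sub]] .
  have from_u: "u \<rightarrow>\<^sup>*\<^bsub>?H\<^esub> w" if "w \<in> verts ?H" for w
    using that induce_reachable_preserves_paths by auto
  show ?thesis unfolding connected_def
  proof (rule strongly_connectedI)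
    show "verts (with_proj (mk_symmetric ?H)) \<noteq> {}" using assms by auto
    fix x y assume "x \<in> verts (with_proj (mk_symmetric ?H))" "y \<in> verts (with_proj (mk_symmetric ?H))"
    then have "u \<rightarrow>\<^sup>*\<^bsub>?H\<^esub> x" "u \<rightarrow>\<^sup>*\<^bsub>?H\<^esub> y" using from_u by auto
    then have "x \<rightarrow>\<^sup>*\<^bsub>?H\<^esub> y" using H.symmetric_reachable' H.reachable_trans by blast
    then show "x \<rightarrow>\<^sup>*\<^bsub>mk_symmetric ?H\<^esub> y" by (rule H.reachable_mk_symmetricI)
  qed
qed

text \<open>Both ends of an arc of \<open>H\<close> are vertices of \<open>H\<close>, hence
  reachable from \<open>u\<close>, so the arc survives the restriction.\<close>

lemma connected_subgraph_of_induce_reachable: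
  assumes "subgraph H G" "Digraph_Component.connected H" "u \<in> verts H"
  shows "subgraph H (G \<restriction> {w. u \<rightarrow>\<^sup>* w})"
proof -
  interpret H: wf_digraph H using assms(1) by auto
  have "verts H \<subseteq> {w. u \<rightarrow>\<^sup>* w}" using connected_subgraph_reachable[OF assms(1,2,3)] by auto
  moreover have "tail G = tail H" "head G = head H" "arcs H \<subseteq> arcs G"
    using assms(1) by (auto simp: compatible_def)
  moreover have "arcs H \<subseteq> arcs (G \<restriction> {w. u \<rightarrow>\<^sup>* w})"
  proof
    fix a assume a: "a \<in> arcs H"
    with H.wellformed[OF a] calculation show "a \<in> arcs (G \<restriction> {w. u \<rightarrow>\<^sup>* w})"
      by (simp add: subset_iff)
  qed
  ultimately show ?thesis
    by (intro subgraphI H.wf_digraph_axioms wellformed_induce_subgraph) (simp_all add: compatible_def)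
qed

text \<open>Replaces maximality by an explicit form: every connected subgraph through
  \<open>u\<close> lies in the subgraph induced on the reachability class of \<open>u\<close>, which
  is itself connected.\<close>

lemma max_connected_subgraphs:
  "{H. max_subgraph Digraph_Component.connected H} = (\<lambda>u. G \<restriction> {w. u \<rightarrow>\<^sup>* w}) ` verts G"
proof (intro equalityI subsetI)
  fix H assume "H \<in> {H. max_subgraph Digraph_Component.connected H}"
  then have max: "max_subgraph Digraph_Component.connected H" by simp
  then have H: "subgraph H G" "Digraph_Component.connected H" by (auto simp: max_subgraph_def)
  from H(2) obtain u where u: "u \<in> verts H"
    by (auto simp: connected_def strongly_connected_def)
  with H(1) have uG: "u \<in> verts G" by auto
  have "{w. u \<rightarrow>\<^sup>* w} \<subseteq> verts G" using reachable_in_verts(2) by auto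
  then have "subgraph (G \<restriction> {w. u \<rightarrow>\<^sup>* w}) G" by (rule subgraph_induce_subgraphI)
  with max connected_induce_reachable[OF uG] connected_subgraph_of_induce_reachable[OF H u]
  have "H = G \<restriction> {w. u \<rightarrow>\<^sup>* w}" by (auto simp: max_subgraph_def)
  with uG show "H \<in> (\<lambda>u. G \<restriction> {w. u \<rightarrow>\<^sup>* w}) ` verts G" by blast
next
  fix H assume "H \<in> (\<lambda>u. G \<restriction> {w. u \<rightarrow>\<^sup>* w}) ` verts G"
  then obtain u where u: "u \<in> verts G" and H: "H = G \<restriction> {w. u \<rightarrow>\<^sup>* w}" by auto
  have "{w. u \<rightarrow>\<^sup>* w} \<subseteq> verts G" using reachable_in_verts(2) by auto
  then have "subgraph H G" unfolding H by (rule subgraph_induce_subgraphI)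
  moreover have "H' = H"
    if sub: "subgraph H H'" "subgraph H' G" and con: "Digraph_Component.connected H'" for H'
  proof -
    have "u \<in> verts H" using u by (simp add: H)
    then have "u \<in> verts H'" using sub(1) by auto
    then have "subgraph H' H"
      unfolding H using sub con connected_subgraph_of_induce_reachable by blast
    with sub(1) show ?thesis
      by (intro pre_digraph.equality) (auto simp: subgraph_def compatible_def)
  qed
  ultimately show "H \<in> {H. max_subgraph Digraph_Component.connected H}"
    using connected_induce_reachable[OF u] unfolding max_subgraph_def H by blast
qed

end

section \<open>Rotation maps\<close>

lemma graph_of_simps [simp]:
  "verts (graph_of G) = Verts G" "arcs (graph_of G) = Verts G \<times> Cols G"
  "tail (graph_of G) = fst" "head (graph_of G) = (\<lambda>x. fst (Rot G x))"
  by (simp_all add: graph_of_def)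

lemma bilabelled_graphD:
  assumes "bilabelled_graph G" "x \<in> Verts G \<times> Cols G"
  shows "Rot G x \<in> Verts G \<times> Cols G" "Rot G (Rot G x) = x"
  using assms by (auto simp: bilabelled_graph_def)

lemma sym_digraph_graph_of:
  assumes "bilabelled_graph G"
  shows "sym_digraph (graph_of G)"
proof -
  have wf: "wf_digraph (graph_of G)"
    by unfold_locales (use bilabelled_graphD(1)[OF assms] in \<open>auto simp: mem_Times_iff\<close>)
  have "symmetric (graph_of G)"
    unfolding symmetric_conv
  proof
    fix x assume "x \<in> arcs (graph_of G)"
    with bilabelled_graphD[OF assms, of x]
    show "\<exists>y\<in>arcs (graph_of G). tail (graph_of G) x = head (graph_of G) y \<and>
        head (graph_of G) x = tail (graph_of G) y"
      by (intro bexI[of _ "Rot G x"]) auto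
  qed
  with wf show ?thesis by (rule wf_digraph.sym_digraphI)
qed

lemma zigzag_simps [simp]:
  "Verts (zigzag G H) = Verts G \<times> Verts H" "Cols (zigzag G H) = Cols H \<times> Cols H"
  by (simp_all add: zigzag_def)

lemma Rot_zigzag:
  assumes "Rot H (k, i) = (k', i')" "Rot G (v, k') = (w, l')" "Rot H (l', j) = (l, j')"
  shows "Rot (zigzag G H) ((v, k), (i, j)) = ((w, l), (j', i'))"
  using assms by (simp add: zigzag_def)

text \<open>Reading the three moves backwards undoes them in the opposite order. The swapped pair
  \<open>(j', i')\<close> lists the labels for exactly this return trip, so the rotation map is an
  involution.\<close>

lemma bilabelled_graph_zigzag:
  assumes G: "bilabelled_graph G" and H: "bilabelled_graph H" and VH: "Verts H = Cols G"
  shows "bilabelled_graph (zigzag G H)"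
proof -
  have "Rot (zigzag G H) x \<in> Verts (zigzag G H) \<times> Cols (zigzag G H) \<and>
      Rot (zigzag G H) (Rot (zigzag G H) x) = x"
    if "x \<in> Verts (zigzag G H) \<times> Cols (zigzag G H)" for x
  proof -
    obtain v k i j where x: "x = ((v, k), (i, j))" by (metis surj_pair)
    obtain k' i' where 1: "Rot H (k, i) = (k', i')" by fastforce
    obtain w l' where 2: "Rot G (v, k') = (w, l')" by fastforce
    obtain l j' where 3: "Rot H (l', j) = (l, j')" by fastforce
    have q1: "k' \<in> Cols G" "i' \<in> Cols H" "Rot H (k', i') = (k, i)"
      using bilabelled_graphD[OF H, of "(k, i)"] that 1 VH by (auto simp: x)
    have q2: "w \<in> Verts G" "l' \<in> Cols G" "Rot G (w, l') = (v, k')"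
      using bilabelled_graphD[OF G, of "(v, k')"] that q1 2 by (auto simp: x)
    have q3: "l \<in> Verts H" "j' \<in> Cols H" "Rot H (l, j') = (l', j)"
      using bilabelled_graphD[OF H, of "(l', j)"] that q2 3 VH by (auto simp: x)
    show ?thesis
      using q1 q2 q3 by (simp add: x Rot_zigzag[OF 1 2 3] Rot_zigzag[OF q3(3) q2(3) q1(3)])
  qed
  then show ?thesis using G H by (simp add: bilabelled_graph_def)
qed

section \<open>Parity blocks and classes of states\<close>

definition parity_of :: "nat \<Rightarrow> parity" where
  "parity_of h = (if even h then Even else Odd)"

lemma parity_of_eq_iff: "parity_of h = parity_of k \<longleftrightarrow> (even h \<longleftrightarrow> even k)"
  by (simp add: parity_of_def)

lemma in_parity_cols_iff: "h \<in> parity_cols G i \<longleftrightarrow> h \<in> Cols G \<and> parity_of h = i"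
  by (cases i) (auto simp: parity_of_def)

lemma cong_2_iff_parity_of: "[h = k] (mod 2) \<longleftrightarrow> parity_of h = parity_of k"
  by (auto simp: parity_of_eq_iff cong_def even_iff_mod_2_eq_zero odd_iff_mod_2_eq_one)

text \<open>The state from which the arc issues. A parity path ending with an arc \<open>y\<close>
  can be continued exactly by the arcs whose state is \<open>arc_state (Rot G y)\<close>.\<close>

definition arc_state :: "'v \<times> nat \<Rightarrow> 'v \<times> parity" where
  "arc_state x = (fst x, parity_of (snd x))"

definition state_rel :: "('v, nat) rot_graph \<Rightarrow> (('v \<times> parity) \<times> ('v \<times> parity)) set" where
  "state_rel G = (\<lambda>x. (arc_state x, arc_state (Rot G x))) ` (Verts G \<times> Cols G)"

definition class_arcs :: "('v, nat) rot_graph \<Rightarrow> 'v \<times> parity \<Rightarrow> ('v \<times> nat) set" where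
  "class_arcs G s = {x \<in> Verts G \<times> Cols G. (s, arc_state x) \<in> (state_rel G)\<^sup>*}"

lemma sym_state_rel:
  assumes "bilabelled_graph G"
  shows "sym (state_rel G)"
proof (rule symI)
  fix s t assume "(s, t) \<in> state_rel G"
  then obtain x where x: "x \<in> Verts G \<times> Cols G" "s = arc_state x" "t = arc_state (Rot G x)"
    by (auto simp: state_rel_def)
  with bilabelled_graphD[OF assms x(1)] show "(t, s) \<in> state_rel G"
    by (auto simp: state_rel_def intro!: image_eqI[of _ _ "Rot G x"])
qed

text \<open>Matching vertices and matching label parities together say that each arc issues from the
  state where the previous one arrives, so the path traces a chain of
  \<open>state_rel\<close>.\<close>

lemma parity_path_arcs:
  assumes "bilabelled_graph G" "parity_path G v i p w"
  shows "set p \<subseteq> class_arcs G (v, i)" "w \<in> (fst \<circ> Rot G) ` set p"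
proof -
  interpret sym_digraph "graph_of G" using sym_digraph_graph_of[OF assms(1)] .
  have walk: "awalk v p w" and "p \<noteq> []" and hd: "parity_of (snd (hd p)) = i"
    and step: "\<And>k. Suc k < length p \<Longrightarrow> parity_of (snd (p ! Suc k)) = parity_of (snd (Rot G (p ! k)))"
    using assms(2) by (auto simp: parity_path_def in_parity_cols_iff cong_2_iff_parity_of)
  have arcs: "set p \<subseteq> Verts G \<times> Cols G" using walk unfolding awalk_def by simp
  \<comment> \<open>The recursive walk predicate is unfolded into conditions on single positions,
    the form in which the parity condition is given.\<close>
  have "w = head (graph_of G) (last p) \<and> v = fst (hd p) \<and>
      (\<forall>k. Suc k < length p \<longrightarrow> fst (p ! Suc k) = fst (Rot G (p ! k)))"
    using walk \<open>p \<noteq> []\<close>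
  proof (induction p arbitrary: v)
    case (Cons x p)
    show ?case
    proof (cases p)
      case Nil
      with Cons.prems show ?thesis by (auto simp: awalk_Cons_iff awalk_Nil_iff)
    next
      case (Cons y q)
      with Cons.IH[of "fst (Rot G x)"] Cons.prems show ?thesis
        by (auto simp: awalk_Cons_iff nth_Cons split: nat.splits)
    qed
  qed simp
  note ends = conjunct1[OF this] conjunct1[OF conjunct2[OF this]]
    conjunct2[OF conjunct2[OF this], rule_format]
  show "w \<in> (fst \<circ> Rot G) ` set p" using ends(1) \<open>p \<noteq> []\<close> by auto
  have "((v, i), arc_state (p ! k)) \<in> (state_rel G)\<^sup>*" if "k < length p" for k
    using that
  proof (induction k)
    case 0
    then show ?case using ends(2) hd \<open>p \<noteq> []\<close> by (simp add: arc_state_def hd_conv_nth)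
  next
    case (Suc k)
    then have "p ! k \<in> Verts G \<times> Cols G" using arcs by (auto dest: nth_mem[of k p])
    then have "(arc_state (p ! k), arc_state (Rot G (p ! k))) \<in> state_rel G"
      by (auto simp: state_rel_def)
    moreover have "arc_state (Rot G (p ! k)) = arc_state (p ! Suc k)"
      using ends(3)[OF Suc.prems] step[OF Suc.prems] by (simp add: arc_state_def)
    ultimately show ?case using Suc by (auto intro: rtrancl_into_rtrancl)
  qed
  then have "((v, i), arc_state x) \<in> (state_rel G)\<^sup>*" if "x \<in> set p" for x
    using that by (metis in_set_conv_nth)
  with arcs show "set p \<subseteq> class_arcs G (v, i)" unfolding class_arcs_def by blast
qed

text \<open>A chain of states lifts to a path by choosing an arc for each link; together with
  \<open>parity_path_arcs\<close> this identifies the arcs used by parity paths.\<close>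

lemma parity_path_to_class_arc:
  assumes G: "bilabelled_graph G" and x: "x \<in> class_arcs G (v, i)"
  shows "\<exists>p. parity_path G v i p (fst (Rot G x)) \<and> x \<in> set p"
proof -
  interpret sym_digraph "graph_of G" using sym_digraph_graph_of[OF G] .
  \<comment> \<open>For the induction \<open>x\<close> has to be the last arc of the path, not just
    a member, and may be any arc issuing from \<open>s\<close>.\<close>
  have "\<exists>p. parity_path G v i p (fst (Rot G x)) \<and> last p = x"
    if "((v, i), s) \<in> (state_rel G)\<^sup>*" "arc_state x = s" "x \<in> Verts G \<times> Cols G" for s x
    using that
  proof (induction arbitrary: x rule: rtrancl_induct)
    case base
    have "fst (Rot G x) \<in> Verts G"
      using bilabelled_graphD(1)[OF G base(2)] by auto
    then have "awalk v [x] (fst (Rot G x))" using base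
      by (auto simp: awalk_Cons_iff awalk_Nil_iff arc_state_def)
    then have "parity_path G v i [x] (fst (Rot G x))" using base
      by (auto simp: parity_path_def in_parity_cols_iff arc_state_def)
    then show ?case by force
  next
    case (step s t)
    from step.hyps(2) obtain y where y: "y \<in> Verts G \<times> Cols G" "arc_state y = s"
      "t = arc_state (Rot G y)" by (auto simp: state_rel_def)
    from step.IH[OF y(2,1)] obtain p where p: "parity_path G v i p (fst (Rot G y))" "last p = y"
      by auto
    have xy: "arc_state x = arc_state (Rot G y)" using step.prems(1) y(3) by simp
    have "fst (Rot G x) \<in> Verts G"
      using bilabelled_graphD(1)[OF G step.prems(2)] by auto
    then have "awalk (fst (Rot G y)) [x] (fst (Rot G x))" using step.prems xy
      by (auto simp: awalk_Cons_iff awalk_Nil_iff arc_state_def)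
    then have "awalk v (p @ [x]) (fst (Rot G x))" using p by (auto simp: parity_path_def)
    moreover have "parity_of (snd ((p @ [x]) ! Suc k)) = parity_of (snd (Rot G ((p @ [x]) ! k)))"
      if "Suc k < length (p @ [x])" for k
    proof (cases "Suc k < length p")
      case True
      then show ?thesis
        using p by (auto simp: parity_path_def cong_2_iff_parity_of nth_append)
    next
      case False
      \<comment> \<open>The only new junction: the old last arc \<open>y\<close> followed by
        \<open>x\<close>.\<close>
      with that have "Suc k = length p" by simp
      then have "p ! k = y" using p(2) by (metis diff_Suc_1 last_conv_nth length_0_conv nat.distinct(1))
      with \<open>Suc k = length p\<close> show ?thesis using xy by (simp add: nth_append arc_state_def)
    qed
    ultimately have "parity_path G v i (p @ [x]) (fst (Rot G x))"
      using p by (auto simp: parity_path_def cong_2_iff_parity_of)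
    then show ?case by force
  qed
  from this[of "arc_state x" x] x obtain p
    where p: "parity_path G v i p (fst (Rot G x))" "last p = x"
    by (auto simp: class_arcs_def)
  then have "x \<in> set p" by (auto simp: parity_path_def)
  with p(1) show ?thesis by blast
qed

lemma Rot_class_arcs:
  assumes "bilabelled_graph G" "x \<in> class_arcs G s"
  shows "Rot G x \<in> class_arcs G s"
proof -
  have x: "x \<in> Verts G \<times> Cols G" "(s, arc_state x) \<in> (state_rel G)\<^sup>*"
    using assms(2) by (auto simp: class_arcs_def)
  have "(arc_state x, arc_state (Rot G x)) \<in> state_rel G" using x(1) by (auto simp: state_rel_def)
  with x bilabelled_graphD(1)[OF assms(1) x(1)] show ?thesis
    by (auto simp: class_arcs_def intro: rtrancl_into_rtrancl)
qed

text \<open>A class of arcs is closed under \<open>Rot G\<close>, so adding the reversed arcs to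
  those used by paths changes nothing.\<close>

lemma parity_block_eq:
  assumes "bilabelled_graph G"
  shows "parity_block G v i =
    \<lparr> verts = (fst \<circ> Rot G) ` class_arcs G (v, i), arcs = class_arcs G (v, i),
      tail = tail (graph_of G), head = head (graph_of G) \<rparr>"
proof -
  have "{w. \<exists>p. parity_path G v i p w} = (fst \<circ> Rot G) ` class_arcs G (v, i)"
    using parity_path_arcs[OF assms, of v i] parity_path_to_class_arc[OF assms, of _ v i]
    by fastforce
  moreover have "{x. \<exists>p w. parity_path G v i p w \<and> x \<in> set p} = class_arcs G (v, i)"
    using parity_path_arcs(1)[OF assms, of v i] parity_path_to_class_arc[OF assms, of _ v i]
    by fast
  moreover have "(\<Union>x \<in> class_arcs G (v, i). {x, Rot G x}) = class_arcs G (v, i)"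
    using Rot_class_arcs[OF assms] by blast
  ultimately show ?thesis unfolding parity_block_def by simp
qed

text \<open>The block determines its arcs, and the arc \<open>x\<close> recovers the class from
  them. Without such an arc, unrelated states could share an empty block.\<close>

lemma parity_block_eq_iff:
  assumes "bilabelled_graph G" "x \<in> Verts G \<times> Cols G" "arc_state x = (v, i)"
  shows "parity_block G v i = parity_block G w j \<longleftrightarrow> ((v, i), (w, j)) \<in> (state_rel G)\<^sup>*"
proof
  assume "parity_block G v i = parity_block G w j"
  then have "class_arcs G (v, i) = class_arcs G (w, j)"
    by (simp add: parity_block_eq[OF assms(1)])
  moreover have "x \<in> class_arcs G (v, i)" using assms by (simp add: class_arcs_def)
  ultimately have "((w, j), (v, i)) \<in> (state_rel G)\<^sup>*" using assms by (simp add: class_arcs_def)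
  then show "((v, i), (w, j)) \<in> (state_rel G)\<^sup>*"
    using sym_rtrancl[OF sym_state_rel[OF assms(1)]] by (auto dest: symD)
next
  assume r: "((v, i), (w, j)) \<in> (state_rel G)\<^sup>*"
  then have "((w, j), (v, i)) \<in> (state_rel G)\<^sup>*"
    using sym_rtrancl[OF sym_state_rel[OF assms(1)]] by (auto dest: symD)
  with r have "class_arcs G (v, i) = class_arcs G (w, j)"
    unfolding class_arcs_def by (auto intro: rtrancl_trans)
  then show "parity_block G v i = parity_block G w j"
    by (simp add: parity_block_eq[OF assms(1)])
qed

section \<open>Components of the zig-zag product\<close>

text \<open>The \<open>Suc\<close> accounts for the first cycle step: the edge of \<open>G\<close>
  crossed next has a colour adjacent to the index, hence of opposite parity when the cycle is
  even.\<close>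

definition vertex_state :: "'v \<times> nat \<Rightarrow> 'v \<times> parity" where
  "vertex_state b = (fst b, parity_of (Suc (snd b)))"

locale zigzag_even_cycle =
  fixes G :: "('v, nat) rot_graph" and C :: "(nat, nat) rot_graph" and d :: nat
  assumes even_d: "even d" and d_ge_3: "d \<ge> 3"
    and regular: "bilabelled_regular_graph d G" and cycle: "cycle_graph d C"
begin

abbreviation "Z \<equiv> graph_of (zigzag G C)"

lemma bilabelled_G: "bilabelled_graph G" and Cols_G [simp]: "Cols G = {1..d}"
  and bilabelled_C: "bilabelled_graph C" and Cols_C [simp]: "Cols C = {1..2}"
  and Verts_C [simp]: "Verts C = {1..d}"
  using regular cycle by (auto simp: bilabelled_regular_graph_def cycle_graph_def)

sublocale Z: sym_digraph Z
  using bilabelled_G bilabelled_C by (intro sym_digraph_graph_of bilabelled_graph_zigzag) auto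

section \<open>Adjacency in the cycle and in the product\<close>

definition neighbour :: "nat \<Rightarrow> nat \<Rightarrow> bool" where
  "neighbour k l \<longleftrightarrow> k \<in> {1..d} \<and> l \<in> {1..d} \<and> ([l = k + 1] (mod d) \<or> [l + 1 = k] (mod d))"

lemma neighbour_sym: "neighbour k l \<Longrightarrow> neighbour l k"
  by (auto simp: neighbour_def cong_sym_eq)

text \<open>Links the arbitrary bi-labelling of \<open>C\<close> to adjacency modulo
  \<open>d\<close>, so that later arguments can avoid cycle labels.\<close>

lemma neighbour_iff_Rot:
  "neighbour k l \<longleftrightarrow> k \<in> {1..d} \<and> (\<exists>i\<in>{1..2}. fst (Rot C (k, i)) = l)"
proof (cases "k \<in> {1..d}")
  case True
  then have "{fst (Rot C (k, i)) | i. i \<in> {1..2}} =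
      {l \<in> {1..d}. [l = k + 1] (mod d) \<or> [l + 1 = k] (mod d)}"
    using cycle unfolding cycle_graph_def by blast
  from arg_cong[where f = "\<lambda>S. l \<in> S", OF this]
  have "(\<exists>i\<in>{1..2}. fst (Rot C (k, i)) = l) \<longleftrightarrow>
      l \<in> {1..d} \<and> ([l = k + 1] (mod d) \<or> [l + 1 = k] (mod d))"
    by (simp only: mem_Collect_eq) blast
  with True show ?thesis unfolding neighbour_def by blast
qed (auto simp: neighbour_def)

text \<open>The evenness of \<open>d\<close> enters here: congruence modulo \<open>d\<close> implies
  congruence modulo 2, also at the wrap-around between \<open>d\<close> and 1.\<close>

lemma neighbour_parity:
  assumes "neighbour k l"
  shows "parity_of l = parity_of (Suc k)"
proof -
  have "[l = k + 1] (mod 2) \<or> [l + 1 = k] (mod 2)"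
    using assms even_d unfolding neighbour_def by (meson cong_dvd_modulus_nat)
  then show ?thesis unfolding cong_2_iff_parity_of by (auto simp: parity_of_eq_iff)
qed

lemma ex_neighbour:
  assumes "k \<in> {1..d}"
  shows "\<exists>l. neighbour k l"
  using assms neighbour_iff_Rot[of k "fst (Rot C (k, 1))"] by force

lemma neighbour_Suc: "1 \<le> k \<Longrightarrow> Suc k \<le> d \<Longrightarrow> neighbour k (Suc k)"
  by (simp add: neighbour_def)

text \<open>Any labels \<open>i\<close> and \<open>j\<close> realising the two cycle steps give an
  arc of the product.\<close>

lemma adj_zigzagI:
  assumes "v \<in> Verts G" "neighbour k k'" "Rot G (v, k') = (w, l')" "neighbour l' l"
  shows "(v, k) \<rightarrow>\<^bsub>Z\<^esub> (w, l)"
proof -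
  obtain i where i: "i \<in> {1..2}" "fst (Rot C (k, i)) = k'"
    using assms(2) neighbour_iff_Rot by blast
  obtain j where j: "j \<in> {1..2}" "fst (Rot C (l', j)) = l"
    using assms(4) neighbour_iff_Rot by blast
  have "Rot (zigzag G C) ((v, k), (i, j)) = ((w, l), (snd (Rot C (l', j)), snd (Rot C (k, i))))"
    using i j assms(3) by (intro Rot_zigzag) auto
  moreover have "((v, k), (i, j)) \<in> arcs Z"
    using i j assms(1,2) by (auto simp: neighbour_def)
  ultimately show ?thesis
    unfolding arcs_ends_conv by (intro image_eqI[of _ _ "((v, k), (i, j))"]) auto
qed

lemma adj_zigzagE:
  assumes "b \<rightarrow>\<^bsub>Z\<^esub> b'"
  obtains v k k' w l' l where "b = (v, k)" "b' = (w, l)" "v \<in> Verts G"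
    "neighbour k k'" "Rot G (v, k') = (w, l')" "neighbour l' l"
proof -
  from assms obtain v k i j where a: "v \<in> Verts G" "k \<in> {1..d}" "i \<in> {1..2}" "j \<in> {1..2}"
    and b: "b = (v, k)" "b' = fst (Rot (zigzag G C) ((v, k), (i, j)))"
    unfolding arcs_ends_conv by auto
  obtain k' i' where 1: "Rot C (k, i) = (k', i')" by fastforce
  obtain w l' where 2: "Rot G (v, k') = (w, l')" by fastforce
  obtain l j' where 3: "Rot C (l', j) = (l, j')" by fastforce
  have k: "neighbour k k'" using a 1 neighbour_iff_Rot by force
  then have "l' \<in> {1..d}"
    using bilabelled_graphD(1)[OF bilabelled_G, of "(v, k')"] a 2 by (auto simp: neighbour_def)
  then have "neighbour l' l" using a 3 neighbour_iff_Rot by force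
  moreover have "b' = (w, l)" by (simp add: b Rot_zigzag[OF 1 2 3])
  ultimately show ?thesis using that a(1) b(1) k 2 by blast
qed

section \<open>Reachability in the product against classes of states\<close>

lemma zigzag_reachable_imp_states:
  assumes "b \<rightarrow>\<^sup>*\<^bsub>Z\<^esub> b'"
  shows "(vertex_state b, vertex_state b') \<in> (state_rel G)\<^sup>*"
  using assms
proof (induction rule: Z.reachable_induct)
  case (step b' b'')
  from step.hyps(2) obtain v k k' w l' l where e: "b' = (v, k)" "b'' = (w, l)" "v \<in> Verts G"
    "neighbour k k'" "Rot G (v, k') = (w, l')" "neighbour l' l"
    by (rule adj_zigzagE)
  \<comment> \<open>The cycle steps from \<open>k\<close> to \<open>k'\<close> and from
    \<open>l\<close> back to \<open>l'\<close> flip parity, so the product edge lies over the edge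
    of \<open>G\<close> that it crosses.\<close>
  have "vertex_state b' = arc_state (v, k')" "vertex_state b'' = arc_state (w, l')"
    using neighbour_parity[OF e(4)] neighbour_parity[OF neighbour_sym[OF e(6)]]
    by (simp_all add: e arc_state_def vertex_state_def)
  moreover have "(v, k') \<in> Verts G \<times> Cols G" using e by (auto simp: neighbour_def)
  ultimately have "(vertex_state b', vertex_state b'') \<in> state_rel G"
    using e(5) by (force simp: state_rel_def)
  with step.IH show ?case by (rule rtrancl_into_rtrancl)
qed simp

text \<open>Both indices can step to \<open>k + 1\<close>, cross the same edge of \<open>G\<close>
  and finish with the same cycle step to \<open>l\<close>.\<close>

lemma zigzag_reachable_add_2:
  assumes "v \<in> Verts G" "1 \<le> k" "k + 2 \<le> d"
  shows "(v, k) \<rightarrow>\<^sup>*\<^bsub>Z\<^esub> (v, k + 2)"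
proof -
  obtain w l' where r: "Rot G (v, Suc k) = (w, l')" by fastforce
  then have "l' \<in> {1..d}"
    using bilabelled_graphD(1)[OF bilabelled_G, of "(v, Suc k)"] assms by auto
  then obtain l where l: "neighbour l' l" using ex_neighbour by blast
  have "neighbour k (Suc k)" "neighbour (k + 2) (Suc k)"
    using assms neighbour_Suc[of k] neighbour_Suc[of "Suc k"] by (auto intro: neighbour_sym)
  then have "(v, k) \<rightarrow>\<^sup>*\<^bsub>Z\<^esub> (w, l)" "(v, k + 2) \<rightarrow>\<^sup>*\<^bsub>Z\<^esub> (w, l)"
    using adj_zigzagI[OF assms(1) _ r l] by auto
  then show ?thesis using Z.symmetric_reachable' Z.reachable_trans by blast
qed

text \<open>Steps of length 2 lead from the smaller index to the larger without wrapping around;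
  symmetry of the product covers the other order.\<close>

lemma zigzag_reachable_same_state:
  assumes "b \<in> verts Z" "b' \<in> verts Z" "vertex_state b = vertex_state b'"
  shows "b \<rightarrow>\<^sup>*\<^bsub>Z\<^esub> b'"
proof -
  have add: "(v, k) \<rightarrow>\<^sup>*\<^bsub>Z\<^esub> (v, k + 2 * n)" if "v \<in> Verts G" "1 \<le> k" "k + 2 * n \<le> d" for v k n
    using that
  proof (induction n)
    case 0
    then show ?case by auto
  next
    case (Suc n)
    with zigzag_reachable_add_2[of v "k + 2 * n"] show ?case
      by (auto intro: Z.reachable_trans simp: add.commute)
  qed
  have le: "(v, k) \<rightarrow>\<^sup>*\<^bsub>Z\<^esub> (v, l)"
    if "v \<in> Verts G" "k \<in> {1..d}" "l \<in> {1..d}" "even k \<longleftrightarrow> even l" "k \<le> l" for v k l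
  proof -
    have "even (l - k)" using that by simp
    then obtain n where "l - k = 2 * n" by (elim evenE)
    then have "l = k + 2 * n" using that by simp
    with add[of v k n] that show ?thesis by simp
  qed
  obtain v k l where b: "b = (v, k)" "b' = (v, l)" "v \<in> Verts G" "k \<in> {1..d}" "l \<in> {1..d}"
    "even k \<longleftrightarrow> even l"
    using assms by (cases b, cases b') (auto simp: vertex_state_def parity_of_eq_iff)
  show ?thesis
    using le[of v k l] le[of v l k] b Z.symmetric_reachable'[of b' b] by (cases "k \<le> l") auto
qed

text \<open>Each link of a chain of states lifts to one product edge. Consecutive lifts need not
  meet in a vertex, but their ends lie over a common state and are joined by
  \<open>zigzag_reachable_same_state\<close>.\<close>

lemma states_imp_zigzag_reachable:
  assumes "(s, t) \<in> (state_rel G)\<^sup>*" "b \<in> verts Z" "b' \<in> verts Z"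
    "vertex_state b = s" "vertex_state b' = t"
  shows "b \<rightarrow>\<^sup>*\<^bsub>Z\<^esub> b'"
  using assms
proof (induction arbitrary: b' rule: rtrancl_induct)
  case base
  then show ?case by (intro zigzag_reachable_same_state) auto
next
  case (step t u)
  from step.hyps(2) obtain v k' where y: "v \<in> Verts G" "k' \<in> {1..d}"
    "t = arc_state (v, k')" "u = arc_state (Rot G (v, k'))"
    by (auto simp: state_rel_def)
  obtain w l' where r: "Rot G (v, k') = (w, l')" by fastforce
  then have w: "w \<in> Verts G" "l' \<in> {1..d}"
    using bilabelled_graphD(1)[OF bilabelled_G, of "(v, k')"] y by auto
  \<comment> \<open>Any neighbours \<open>k\<close> of \<open>k'\<close> and \<open>l\<close> of
    \<open>l'\<close> serve, since parity alone puts the lifted ends over \<open>t\<close> and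
    \<open>u\<close>.\<close>
  obtain k where k: "neighbour k' k" using ex_neighbour y(2) by blast
  obtain l where l: "neighbour l' l" using ex_neighbour w(2) by blast
  have "(v, k) \<in> verts Z" "(w, l) \<in> verts Z"
    using k l y w by (auto simp: neighbour_def)
  moreover have "vertex_state (v, k) = t" "vertex_state (w, l) = u"
    using neighbour_parity[OF neighbour_sym[OF k]] neighbour_parity[OF neighbour_sym[OF l]] y r
    by (simp_all add: arc_state_def vertex_state_def)
  ultimately have "b \<rightarrow>\<^sup>*\<^bsub>Z\<^esub> (v, k)" "(w, l) \<rightarrow>\<^sup>*\<^bsub>Z\<^esub> b'"
    using step.IH[of "(v, k)"] step.prems zigzag_reachable_same_state by auto
  moreover have "(v, k) \<rightarrow>\<^bsub>Z\<^esub> (w, l)"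
    using y(1) neighbour_sym[OF k] r l by (rule adj_zigzagI)
  ultimately show ?case by (meson Z.reachable_adj_trans Z.reachable_trans)
qed

lemma zigzag_reachable_iff:
  assumes "b \<in> verts Z" "b' \<in> verts Z"
  shows "b \<rightarrow>\<^sup>*\<^bsub>Z\<^esub> b' \<longleftrightarrow> (vertex_state b, vertex_state b') \<in> (state_rel G)\<^sup>*"
  using assms zigzag_reachable_imp_states states_imp_zigzag_reachable by blast

text \<open>The index has parity opposite to \<open>i\<close>, whence the witnesses 1 for
  \<open>Even\<close> and 2 for \<open>Odd\<close>. So every parity block comes from a vertex of the
  product.\<close>

lemma state_of_vertex:
  assumes "v \<in> Verts G"
  shows "\<exists>k\<in>{1..d}. vertex_state (v, k) = (v, i)"
proof (cases i)
  case Even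
  then show ?thesis using d_ge_3 by (intro bexI[of _ 1]) (auto simp: vertex_state_def parity_of_def)
next
  case Odd
  then show ?thesis using d_ge_3 by (intro bexI[of _ 2]) (auto simp: vertex_state_def parity_of_def)
qed

text \<open>Supplies the arc required by \<open>parity_block_eq_iff\<close>: a cycle neighbour of
  the index is a colour of the right parity.\<close>

lemma vertex_state_arc:
  assumes "b \<in> verts Z"
  shows "\<exists>x\<in>Verts G \<times> Cols G. arc_state x = vertex_state b"
proof -
  obtain v k where b: "b = (v, k)" "v \<in> Verts G" "k \<in> {1..d}" using assms by auto
  obtain k' where "neighbour k k'" using ex_neighbour[OF b(3)] by blast
  then show ?thesis
    using b neighbour_parity
    by (intro bexI[of _ "(v, k')"]) (auto simp: neighbour_def arc_state_def vertex_state_def)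
qed

section \<open>Blocks and components indexed by the vertices of the product\<close>

definition block :: "'v \<times> nat \<Rightarrow> ('v, 'v \<times> nat) pre_digraph" where
  "block b = (case vertex_state b of (v, i) \<Rightarrow> parity_block G v i)"

definition component :: "'v \<times> nat \<Rightarrow> ('v \<times> nat, ('v \<times> nat) \<times> (nat \<times> nat)) pre_digraph" where
  "component b = Z \<restriction> {b'. b \<rightarrow>\<^sup>*\<^bsub>Z\<^esub> b'}"

lemma parity_blocks_eq: "parity_blocks G = block ` verts Z"
proof (intro equalityI subsetI)
  fix P assume "P \<in> parity_blocks G"
  then obtain v i where P: "P = parity_block G v i" and v: "v \<in> Verts G"
    by (auto simp: parity_blocks_def)
  obtain k where k: "k \<in> {1..d}" "vertex_state (v, k) = (v, i)" using state_of_vertex[OF v] by blast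
  then have "P = block (v, k)" by (simp add: P block_def)
  with v k(1) show "P \<in> block ` verts Z" by auto
next
  fix P assume "P \<in> block ` verts Z"
  then show "P \<in> parity_blocks G"
    by (auto simp: parity_blocks_def block_def vertex_state_def)
qed

lemma connected_components_eq: "connected_components (zigzag G C) = component ` verts Z"
  unfolding connected_components_def component_def by (rule Z.max_connected_subgraphs)

lemma component_eq_iff:
  assumes "b \<in> verts Z" "b' \<in> verts Z"
  shows "component b = component b' \<longleftrightarrow> b \<rightarrow>\<^sup>*\<^bsub>Z\<^esub> b'"
proof
  assume "component b = component b'"
  then have "{x. b \<rightarrow>\<^sup>*\<^bsub>Z\<^esub> x} = {x. b' \<rightarrow>\<^sup>*\<^bsub>Z\<^esub> x}"
    unfolding component_def by (metis induce_subgraph_verts)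
  moreover have "b' \<in> {x. b' \<rightarrow>\<^sup>*\<^bsub>Z\<^esub> x}" using assms(2) by simp
  ultimately show "b \<rightarrow>\<^sup>*\<^bsub>Z\<^esub> b'" by blast
next
  assume r: "b \<rightarrow>\<^sup>*\<^bsub>Z\<^esub> b'"
  then have "{x. b \<rightarrow>\<^sup>*\<^bsub>Z\<^esub> x} = {x. b' \<rightarrow>\<^sup>*\<^bsub>Z\<^esub> x}"
    using Z.reachable_trans[OF r] Z.reachable_trans[OF Z.symmetric_reachable'[OF r]]
    by (intro Collect_cong iffI)
  then show "component b = component b'" by (simp add: component_def)
qed

text \<open>Either equality means that the two vertex states lie in one class of
  \<open>state_rel\<close>.\<close>

lemma block_eq_iff_component_eq:
  assumes "b \<in> verts Z" "b' \<in> verts Z"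
  shows "block b = block b' \<longleftrightarrow> component b = component b'"
proof -
  obtain x where x: "x \<in> Verts G \<times> Cols G" "arc_state x = vertex_state b"
    using vertex_state_arc[OF assms(1)] by blast
  obtain v i w j where s: "vertex_state b = (v, i)" "vertex_state b' = (w, j)" by fastforce
  have "block b = block b' \<longleftrightarrow> (vertex_state b, vertex_state b') \<in> (state_rel G)\<^sup>*"
    using parity_block_eq_iff[OF bilabelled_G x(1), of v i w j] x(2) by (simp add: block_def s)
  then show ?thesis using zigzag_reachable_iff component_eq_iff assms by blast
qed

end

text \<open>As \<open>g\<close> and \<open>h\<close> have the same fibres on \<open>A\<close>,
  sending \<open>g x\<close> to \<open>h x\<close> does not depend on the representative chosen by
  \<open>inv_into\<close> and is injective.\<close>

lemma ex_bij_betw_images: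
  assumes "\<And>x y. x \<in> A \<Longrightarrow> y \<in> A \<Longrightarrow> g x = g y \<longleftrightarrow> h x = h y"
  shows "\<exists>f. bij_betw f (g ` A) (h ` A)"
proof (intro exI)
  have "inv_into A g (g x) \<in> A" "h (inv_into A g (g x)) = h x" if "x \<in> A" for x
  proof -
    show *: "inv_into A g (g x) \<in> A" using that by (intro inv_into_into imageI)
    have "g (inv_into A g (g x)) = g x" using that by (intro f_inv_into_f imageI)
    then show "h (inv_into A g (g x)) = h x" using assms[OF * that] by simp
  qed
  then show "bij_betw (h \<circ> inv_into A g) (g ` A) (h ` A)"
    using assms by (auto simp: bij_betw_def inj_on_def image_image)
qed

theorem theorem4p3:
  fixes G :: "('v, nat) rot_graph" and C :: "(nat, nat) rot_graph" and d :: nat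
  assumes "even d" and "d \<ge> 3"
    and "bilabelled_regular_graph d G"
    and "Digraph_Component.connected (graph_of G)"
    and "cycle_graph d C"
  shows "\<exists>f. bij_betw f (parity_blocks G) (connected_components (zigzag G C))"
proof -
  interpret zigzag_even_cycle G C d using assms by unfold_locales
  show ?thesis
    unfolding parity_blocks_eq connected_components_eq
    by (rule ex_bij_betw_images) (rule block_eq_iff_component_eq)
qed

end
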